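(* If $N\ge3$ is an integer, then $\mathcal{T}_{\mathbb{R}}(\Omega_N)=2$.
   Context: For $\lambda\ge 0$ let $\Omega_\lambda=(-1,1)\cup(\lambda-1,\lambda+1)\cup(-\lambda-1,-\lambda+1)\subset\mathbb{R}$; $\Omega_N$ is the case $\lambda=N$. A function $f:\mathbb{R}\to\mathbb{C}$ is positive definite if $\sum_{j,k=1}^m z_j\overline{z_k}f(x_j-x_k)\ge 0$ for all finite choices of $x_1,\dots,x_m\in\mathbb{R}$ and $z_1,\dots,z_m\in\mathbb{C}$. For an open bounded set $\Omega\subset\mathbb{R}$ with $\Omega=-\Omega$ and $0\in\Omega$, the Turán constant is $$\mathcal{T}_{\mathbb{R}}(\Omega)=\sup\left\{\int_{\mathbb{R}}f(x)\,dx: f\in C(\mathbb{R}),\ f \text{ positive definite},\ f(0)=1,\ \operatorname{supp} f\subset\Omega\right\},$$ where $\operatorname{supp} f$ is the closed support of $f$ (the integrals in question are automatically real). *)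

theory Defs
  imports "HOL-Analysis.Analysis"
begin

text \<open>Membership in \<open>\<real>\<^sub>\<ge>\<^sub>0\<close> says that the complex sum is real and nonnegative.\<close>

definition positive_definite :: "(real \<Rightarrow> complex) \<Rightarrow> bool" where
  "positive_definite f \<longleftrightarrow>
     (\<forall>(m::nat) (x :: nat \<Rightarrow> real) (z :: nat \<Rightarrow> complex).
        (\<Sum>j=1..m. \<Sum>k=1..m. z j * cnj (z k) * f (x j - x k)) \<in> \<real>\<^sub>\<ge>\<^sub>0)"

definition turan_class :: "real set \<Rightarrow> (real \<Rightarrow> complex) set" where
  "turan_class \<Omega> =
     {f. continuous_on UNIV f \<and> positive_definite f \<and> f 0 = 1 \<and>
         closure (support_on UNIV f) \<subseteq> \<Omega>}"

text \<open>
  Intended for bounded open symmetric \<open>\<Omega>\<close> containing 0. The functions in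
  \<open>turan_class \<Omega>\<close> are then continuous with compact support, hence integrable, and their
  integrals are real by positive definiteness, so \<open>Re\<close> loses nothing. The supremum is taken
  in \<open>ereal\<close>, where it is meaningful without a prior boundedness or nonemptiness argument.
\<close>

definition turan_constant :: "real set \<Rightarrow> ereal" where
  "turan_constant \<Omega> = (SUP f \<in> turan_class \<Omega>. ereal (Re (LINT x|lborel. f x)))"

definition Omega :: "real \<Rightarrow> real set" where
  "Omega l = {-1<..<1} \<union> {l - 1<..<l + 1} \<union> {- l - 1<..<- l + 1}"

end

theory Submission
  imports Defs
begin

text \<open>
  The upper bound is a packing argument. Let \<open>\<Lambda>\<close> be the set of integers whose residue modulo
  \<open>2 N\<close> lies in \<open>{0, \<dots>, N - 1}\<close>. It has density \<open>1/2\<close>, and no two of its points differ by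
  \<open>\<plusminus>N\<close>; since the only integers in \<open>\<Omega>\<^sub>N\<close> are \<open>0\<close> and \<open>\<plusminus>N\<close>, the difference set of \<open>\<Lambda>\<close> meets
  \<open>\<Omega>\<^sub>N\<close> only in \<open>0\<close>. Test positive definiteness of \<open>f\<close> on the signed measure \<open>\<nu>\<close> that puts a
  unit mass at each point of \<open>\<Lambda>\<close> and subtracts Lebesgue measure with the same density \<open>1/2\<close>.
  Per unit of length, the form \<open>\<integral>\<integral> f(x - y) d\<nu>(x) d\<nu>(y)\<close> receives \<open>f(0)/2\<close> from \<open>\<Lambda>\<close> against
  itself, and \<open>1/4 - 2/4\<close> times \<open>\<integral> f\<close> from the remaining terms. So \<open>1/2 - (\<integral> f)/4 \<ge> 0\<close>, which
  is \<open>\<integral> f \<le> 2\<close>.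

  Positive definiteness concerns finite sums, so Lebesgue measure is replaced by equal masses on
  the grid of mesh \<open>1/q\<close>, and the mean of the form is taken over long windows: the weights are
  periodic, and the window ends contribute only a bounded error
  (\<open>positive_definite_periodic_form\<close>). This yields the bound for the Riemann sums of \<open>f\<close>
  (\<open>positive_definite_grid_sum_le\<close>), and then for the integral as \<open>q\<close> grows
  (\<open>turan_class_integral_le\<close>).

  For the lower bound, take a tent of height \<open>1\<close> and half-width \<open>r < 1\<close> at \<open>0\<close>, and tents of
  height \<open>1/2\<close> at \<open>\<plusminus>N\<close>. Up to scaling this is the autocorrelation of the indicator of
  \<open>[0, r] \<union> [N, N + r]\<close>, hence positive definite, and its integral is \<open>2 r\<close>
  (\<open>three_tents_in_turan_class\<close>, \<open>integral_three_tents\<close>). For \<open>r = 1\<close> the closed support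
  would leave the open set \<open>\<Omega>\<^sub>N\<close>, so the value \<open>2\<close> is reached in the limit \<open>r \<rightarrow> 1\<close>.
\<close>

section \<open>Positive definiteness tested on periodic weights\<close>

lemma positive_definite_grid_form:
  fixes z :: "int \<Rightarrow> real"
  assumes "positive_definite f"
  shows "0 \<le> (\<Sum>k\<in>{0..<int M}. \<Sum>j\<in>{0..<int M}. z k * z j * Re (f (of_int (j - k) * h)))"
proof -
  define x where "x = (\<lambda>j. real_of_int (int j - 1) * h)"
  define w where "w = (\<lambda>j. complex_of_real (z (int j - 1)))"
  have "(\<Sum>j=1..M. \<Sum>k=1..M. w j * cnj (w k) * f (x j - x k)) \<in> \<real>\<^sub>\<ge>\<^sub>0"
    using assms unfolding positive_definite_def by blast
  then have "0 \<le> Re (\<Sum>j=1..M. \<Sum>k=1..M. w j * cnj (w k) * f (x j - x k))"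
    by (simp add: complex_nonneg_Reals_iff)
  also have "\<dots> = (\<Sum>j=1..M. \<Sum>k=1..M.
      z (int k - 1) * z (int j - 1) * Re (f (of_int ((int j - 1) - (int k - 1)) * h)))"
    by (simp add: w_def x_def algebra_simps flip: of_real_mult)
  also have "\<dots> = (\<Sum>j\<in>{0..<int M}. \<Sum>k\<in>{0..<int M}. z k * z j * Re (f (of_int (j - k) * h)))"
  proof -
    have reindex: "(\<Sum>j=1..M. g (int j - 1)) = (\<Sum>j\<in>{0..<int M}. g j)" for g :: "int \<Rightarrow> real"
      by (rule sum.reindex_bij_witness[of _ "\<lambda>i. nat (i + 1)" "\<lambda>j. int j - 1"]) auto
    have "(\<Sum>k=1..M. z (int k - 1) * z j * Re (f (of_int (j - (int k - 1)) * h)))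
        = (\<Sum>k\<in>{0..<int M}. z k * z j * Re (f (of_int (j - k) * h)))" for j
      by (rule reindex)
    then show ?thesis
      by (simp only: reindex[of "\<lambda>j. \<Sum>k\<in>{0..<int M}. z k * z j * Re (f (of_int (j - k) * h))"])
  qed
  also have "\<dots> = (\<Sum>k\<in>{0..<int M}. \<Sum>j\<in>{0..<int M}. z k * z j * Re (f (of_int (j - k) * h)))"
    by (rule sum.swap)
  finally show ?thesis .
qed

lemma sum_over_periods:
  fixes u :: "int \<Rightarrow> real"
  assumes "\<And>k. u (k + int L) = u k"
  shows "(\<Sum>k\<in>{0..<int (K * L)}. u k) = real K * (\<Sum>k\<in>{0..<int L}. u k)"
proof (induction K)
  case (Suc K)
  have per: "u (k + int (K * L)) = u k" for k
  proof (induction K)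
    case (Suc K)
    have "u (k + int (Suc K * L)) = u ((k + int (K * L)) + int L)"
      by (simp add: algebra_simps)
    with assms Suc.IH show ?case by simp
  qed simp
  have "{0..<int (Suc K * L)} = {0..<int (K * L)} \<union> {int (K * L)..<int (K * L) + int L}"
    by (simp add: ivl_disj_un algebra_simps)
  then have "sum u {0..<int (Suc K * L)}
      = sum u {0..<int (K * L)} + sum u {int (K * L)..<int (K * L) + int L}"
    by (simp add: sum.union_disjoint ivl_disj_int del: of_nat_mult)
  also have "sum u {int (K * L)..<int (K * L) + int L} = (\<Sum>k\<in>{0..<int L}. u (k + int (K * L)))"
    by (rule sum.reindex_bij_witness[of _ "\<lambda>k. k + int (K * L)" "\<lambda>k. k - int (K * L)"]) auto
  finally show ?case
    by (simp add: per Suc.IH algebra_simps del: of_nat_mult)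
qed simp

lemma sum_period_shift:
  fixes u :: "int \<Rightarrow> real"
  assumes per: "\<And>k. u (k + L) = u k" and "L > 0"
  shows "(\<Sum>k\<in>{0..<L}. u (k + d)) = (\<Sum>k\<in>{0..<L}. u k)"
proof -
  have step: "(\<Sum>k\<in>{0..<L}. v (k + 1)) = (\<Sum>k\<in>{0..<L}. v k)"
    if "\<And>k. v (k + L) = v k" for v :: "int \<Rightarrow> real"
  proof -
    have "(\<Sum>k\<in>{0..<L}. v (k + 1)) = (\<Sum>k\<in>{1..<L+1}. v k)"
      by (rule sum.reindex_bij_witness[of _ "\<lambda>k. k - 1" "\<lambda>k. k + 1"]) auto
    also have "{1..<L+1} = insert L {1..<L}" using \<open>L > 0\<close> by auto
    also have "sum v \<dots> = v 0 + sum v {1..<L}" using that[of 0] by simp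
    also have "\<dots> = sum v (insert 0 {1..<L})" by simp
    also have "insert 0 {1..<L} = {0..<L}" using \<open>L > 0\<close> by auto
    finally show ?thesis .
  qed
  show ?thesis
  proof (induction d rule: int_induct[where k = 0])
    case (step1 d)
    then show ?case
      using step[of "\<lambda>k. u (k + d)"] per[of "_ + d"] by (simp add: add_ac)
  next
    case (step2 d)
    then show ?case
      using step[of "\<lambda>k. u (k + (d - 1))"] per[of "_ + (d - 1)"] by (simp add: algebra_simps)
  qed simp
qed

lemma nonneg_if_linear_bounded_below:
  fixes T C :: real
  assumes "\<And>K::nat. 0 \<le> real K * T + C"
  shows "0 \<le> T"
proof (rule ccontr)
  assume "\<not> 0 \<le> T"
  then obtain K :: nat where "C < real K * (- T)"
    using reals_Archimedean3[of "- T"] by auto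
  with assms[of K] show False by simp
qed

text \<open>
  On a window of \<open>K\<close> periods the quadratic form is a sum over pairs of grid points, grouped by
  their difference \<open>d\<close>. If both points were free, each difference would contribute exactly \<open>K\<close>
  times the correlation of \<open>z\<close> over one period. Requiring both to be in the window loses at most
  \<open>D\<close> pairs for each \<open>d\<close>, an error independent of \<open>K\<close>; letting \<open>K\<close> grow leaves the correlation
  sum.
\<close>
lemma positive_definite_periodic_form:
  fixes z :: "int \<Rightarrow> real" and h :: real
  assumes pd: "positive_definite f"
    and per: "\<And>k. z (k + int L) = z k" and bound: "\<And>k. \<bar>z k\<bar> \<le> B"
    and supp: "\<And>d. \<bar>d\<bar> > int D \<Longrightarrow> f (of_int d * h) = 0"
  shows "0 \<le> (\<Sum>d\<in>{- int D..int D}. Re (f (of_int d * h)) * (\<Sum>k\<in>{0..<int L}. z (k + d) * z k))"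
    (is "0 \<le> ?T")
proof (rule nonneg_if_linear_bounded_below)
  fix K :: nat
  define a where "a = (\<lambda>d. Re (f (of_int d * h)))"
  define I where "I = {- int D..int D}"
  define W where "W = {0..<int (K * L)}"
  have a_zero: "a d = 0" if "d \<notin> I" for d
    using supp[of d] that by (auto simp: a_def I_def)
  let ?C = "\<Sum>d\<in>I. \<bar>a d\<bar> * (real D * (B * B))"
  have "0 \<le> (\<Sum>k\<in>W. \<Sum>j\<in>W. z k * z j * a (j - k))"
    using positive_definite_grid_form[OF pd, where M = "K * L" and z = z and h = h] by (simp add: W_def a_def)
  also have "\<dots> = (\<Sum>k\<in>W. \<Sum>d\<in>I. if k + d \<in> W then a d * (z (k + d) * z k) else 0)"
  proof (rule sum.cong[OF refl])
    fix k
    have "(\<Sum>j\<in>W. z k * z j * a (j - k))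
        = (\<Sum>j\<in>{j\<in>W. j - k \<in> I}. z k * z j * a (j - k))"
      by (rule sum.mono_neutral_right) (auto simp: W_def a_zero)
    also have "\<dots> = (\<Sum>d\<in>{d\<in>I. k + d \<in> W}. a d * (z (k + d) * z k))"
      by (rule sum.reindex_bij_witness[of _ "\<lambda>d. k + d" "\<lambda>j. j - k"]) auto
    also have "\<dots> = (\<Sum>d\<in>I. if k + d \<in> W then a d * (z (k + d) * z k) else 0)"
      by (rule sum.inter_filter) (simp add: I_def)
    finally show "(\<Sum>j\<in>W. z k * z j * a (j - k)) = \<dots>" .
  qed
  also have "\<dots> = (\<Sum>d\<in>I. \<Sum>k\<in>W. if k + d \<in> W then a d * (z (k + d) * z k) else 0)"
    by (rule sum.swap)
  also have "\<dots> \<le> (\<Sum>d\<in>I. a d * (\<Sum>k\<in>W. z (k + d) * z k) + \<bar>a d\<bar> * (real D * (B * B)))"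
  proof (rule sum_mono)
    fix d assume "d \<in> I"
    let ?E = "{k\<in>W. k + d \<notin> W}"
    have "?E \<subseteq> (if d \<ge> 0 then {int (K * L) - d..<int (K * L)} else {0..<- d})"
      by (auto simp: W_def)
    then have "card ?E \<le> card (if d \<ge> 0 then {int (K * L) - d..<int (K * L)} else {0..<- d})"
      by (rule card_mono[rotated]) auto
    also have "\<dots> \<le> D" using \<open>d \<in> I\<close> by (auto simp: I_def)
    finally have card: "card ?E \<le> D" .
    have "B \<ge> 0" using bound[of 0] by linarith
    have edge: "- (a d * (z (k + d) * z k)) \<le> \<bar>a d\<bar> * (B * B)" for k
    proof -
      have "\<bar>z (k + d) * z k\<bar> \<le> B * B"
        unfolding abs_mult using bound \<open>B \<ge> 0\<close> by (intro mult_mono) auto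
      then have "\<bar>a d\<bar> * \<bar>z (k + d) * z k\<bar> \<le> \<bar>a d\<bar> * (B * B)"
        by (intro mult_left_mono) auto
      then show ?thesis by (metis abs_ge_minus_self abs_mult order_trans)
    qed
    have "(\<Sum>k\<in>W. if k + d \<in> W then a d * (z (k + d) * z k) else 0) - a d * (\<Sum>k\<in>W. z (k + d) * z k)
        = (\<Sum>k\<in>W. if k + d \<notin> W then - (a d * (z (k + d) * z k)) else 0)"
      unfolding sum_distrib_left sum_subtractf[symmetric] by (rule sum.cong) auto
    also have "\<dots> = (\<Sum>k\<in>?E. - (a d * (z (k + d) * z k)))"
      by (rule sum.inter_filter[symmetric]) (simp add: W_def)
    also have "\<dots> \<le> real (card ?E) * (\<bar>a d\<bar> * (B * B))"
      by (rule sum_bounded_above) (rule edge)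
    also have "\<dots> \<le> real D * (\<bar>a d\<bar> * (B * B))"
      using card \<open>B \<ge> 0\<close> by (intro mult_right_mono) auto
    finally show "(\<Sum>k\<in>W. if k + d \<in> W then a d * (z (k + d) * z k) else 0)
        \<le> a d * (\<Sum>k\<in>W. z (k + d) * z k) + \<bar>a d\<bar> * (real D * (B * B))"
      by (simp add: algebra_simps)
  qed
  also have "\<dots> = (\<Sum>d\<in>I. a d * (real K * (\<Sum>k\<in>{0..<int L}. z (k + d) * z k))) + ?C"
  proof -
    have "(\<Sum>k\<in>W. z (k + d) * z k) = real K * (\<Sum>k\<in>{0..<int L}. z (k + d) * z k)" for d
      unfolding W_def
    proof (rule sum_over_periods)
      fix k
      show "z (k + int L + d) * z (k + int L) = z (k + d) * z k"
        using per[of k] per[of "k + d"] by (simp add: add_ac)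
    qed
    then show ?thesis by (simp add: sum.distrib)
  qed
  also have "\<dots> = real K * ?T + ?C"
    by (simp add: sum_distrib_left a_def I_def mult_ac)
  finally show "0 \<le> real K * ?T + ?C" .
qed


section \<open>The packing bound for sums over a grid\<close>

lemma sum_residue_block_indicator:
  assumes "n > 0" "q > 0"
  defines "w \<equiv> \<lambda>k::int. of_bool (int q dvd k \<and> (k div int q) mod int (2 * n) < int n) :: real"
  shows "(\<Sum>k\<in>{0..<int (2 * n * q)}. w k) = real n"
proof -
  have "{k\<in>{0..<int (2 * n * q)}. int q dvd k \<and> (k div int q) mod int (2 * n) < int n}
      = (\<lambda>e. int q * e) ` {0..<int n}" (is "?A = ?B")
  proof (intro equalityI subsetI)
    fix k assume k: "k \<in> ?A"
    then obtain e where e: "k = int q * e" by auto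
    have "0 \<le> e" using k e assms by (auto simp: zero_le_mult_iff)
    moreover have "int q * e < int q * int (2 * n)" using k e by (simp add: mult_ac)
    then have "e < int (2 * n)" using assms(2) by (simp only: mult_less_cancel_left_pos of_nat_0_less_iff)
    ultimately have "e < int n" using k e assms by auto
    with \<open>0 \<le> e\<close> e show "k \<in> ?B" by auto
  next
    fix k assume "k \<in> ?B"
    then obtain e where "k = int q * e" "e \<in> {0..<int n}" by blast
    then have e: "k = int q * e" "0 \<le> e" "e < int n" by auto
    have "int q * e < int q * int (2 * n)"
      using e assms by (intro mult_strict_left_mono) auto
    with e assms show "k \<in> ?A" by (auto simp: mult_ac)
  qed
  moreover have "inj_on (\<lambda>e. int q * e) {0..<int n}"
    using assms by (auto simp: inj_on_def)
  ultimately have "card {k\<in>{0..<int (2 * n * q)}. int q dvd k \<and> (k div int q) mod int (2 * n) < int n} = n"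
    by (simp add: card_image)
  moreover have "(\<Sum>k\<in>{0..<int (2 * n * q)}. w k) =
      (\<Sum>k\<in>{k\<in>{0..<int (2 * n * q)}. int q dvd k \<and> (k div int q) mod int (2 * n) < int n}. 1)"
    unfolding w_def of_bool_def by (subst sum.inter_filter) simp_all
  ultimately show ?thesis by simp
qed

text \<open>
  A shift by \<open>n\<close> or by \<open>- n\<close> is the same modulo \<open>2 n\<close>, and it exchanges the two halves of the
  residues.
\<close>
lemma residue_block_avoids_half_period:
  fixes m e n :: int
  assumes "m mod (2 * n) < n" "(m + e) mod (2 * n) < n" "n > 0"
  shows "\<bar>e\<bar> \<noteq> n"
proof
  assume "\<bar>e\<bar> = n"
  then have "(m + e) mod (2 * n) = (m + n) mod (2 * n)"
    by (smt (verit) mod_add_self2)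
  also have "\<dots> = (m mod (2 * n) + n) mod (2 * n)"
    by (simp add: mod_add_left_eq)
  also have "\<dots> = m mod (2 * n) + n"
    using assms by (intro mod_pos_pos_trivial) (auto intro: add_nonneg_nonneg)
  also have "\<dots> \<ge> n" using assms by simp
  finally show False using assms by simp
qed

text \<open>
  The periodic form is applied to \<open>z = w - c\<close>, where \<open>w\<close> marks the points of the packing set
  \<open>\<Lambda>\<close> on the grid and \<open>c\<close> is the mean of \<open>w\<close>. Because \<open>z\<close> has mean zero, its correlation at
  difference \<open>d\<close> is that of \<open>w\<close> minus the constant \<open>n c\<close>, and the support of \<open>f\<close> sees the
  correlation of \<open>w\<close> only at \<open>d = 0\<close>.
\<close>
lemma positive_definite_grid_sum_le:
  assumes pd: "positive_definite f" and f0: "f 0 = 1"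
    and supp: "\<And>x. x \<notin> Omega (real n) \<Longrightarrow> f x = 0"
    and "n > 0" "q > 0"
  shows "(\<Sum>d\<in>{- int ((n + 1) * q)..int ((n + 1) * q)}. Re (f (of_int d / q))) \<le> 2 * real q"
proof -
  define w where "w = (\<lambda>k::int. of_bool (int q dvd k \<and> (k div int q) mod int (2 * n) < int n) :: real)"
  \<comment> \<open>One period of the grid has \<open>2 n q\<close> points, of which \<open>n\<close> are marked.\<close>
  define c where "c = 1 / (2 * real q)"
  define z where "z = (\<lambda>k. w k - c)"
  define L where "L = 2 * n * q"
  define D where "D = (n + 1) * q"
  define I where "I = {- int D..int D}"
  define a where "a = (\<lambda>d. Re (f (of_int d / q)))"
  have w_per: "w (k + int L) = w k" for k
  proof -
    have "(k + int L) div int q = k div int q + int (2 * n)"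
      using div_mult_self1[of "int q" k "int (2 * n)"] \<open>q > 0\<close> by (simp add: L_def)
    moreover have "int q dvd k + int L \<longleftrightarrow> int q dvd k"
      by (simp add: L_def dvd_add_left_iff)
    ultimately show ?thesis
      unfolding w_def by (simp only: mod_add_self2)
  qed
  have w_sum: "(\<Sum>k\<in>{0..<int L}. w k) = real n"
    unfolding w_def L_def using sum_residue_block_indicator assms by blast
  have w_shift: "(\<Sum>k\<in>{0..<int L}. w (k + d)) = real n" for d
    using sum_period_shift[of w "int L" d] w_per w_sum assms by (simp add: L_def)
  have corr: "(\<Sum>k\<in>{0..<int L}. z (k + d) * z k)
      = (\<Sum>k\<in>{0..<int L}. w (k + d) * w k) - real n * c" for d
  proof -
    have "(\<Sum>k\<in>{0..<int L}. z (k + d) * z k)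
      = (\<Sum>k\<in>{0..<int L}. w (k + d) * w k) - c * (\<Sum>k\<in>{0..<int L}. w (k + d))
        - c * (\<Sum>k\<in>{0..<int L}. w k) + real L * c * c"
      by (simp add: z_def algebra_simps sum.distrib sum_subtractf sum_distrib_left)
    also have "real L * c = real n"
      using \<open>q > 0\<close> by (simp add: L_def c_def)
    finally show ?thesis by (simp add: w_shift w_sum)
  qed
  have offdiag: "a d * (w (k + d) * w k) = 0" if "d \<noteq> 0" for d k
  proof (rule ccontr)
    assume "a d * (w (k + d) * w k) \<noteq> 0"
    then have "a d \<noteq> 0" "w (k + d) \<noteq> 0" "w k \<noteq> 0" by auto
    then have "of_int d / real q \<in> Omega (real n)"
      using supp unfolding a_def by (metis zero_complex.sel(1))
    moreover obtain e where e: "d = int q * e"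
      using \<open>w (k + d) \<noteq> 0\<close> \<open>w k \<noteq> 0\<close> by (auto simp: w_def dvd_add_right_iff)
    ultimately have "of_int e \<in> Omega (real n)" using \<open>q > 0\<close> by simp
    moreover have "e \<noteq> 0" using e that by auto
    ultimately have "\<bar>e\<bar> = int n" by (auto simp: Omega_def)
    moreover have "(k + d) div int q = k div int q + e"
      using e \<open>q > 0\<close> by simp
    then have "(k div int q) mod (2 * int n) < int n" "(k div int q + e) mod (2 * int n) < int n"
      using \<open>w (k + d) \<noteq> 0\<close> \<open>w k \<noteq> 0\<close> by (auto simp: w_def)
    ultimately show False
      using residue_block_avoids_half_period[of "k div int q" "int n" e] \<open>n > 0\<close> by auto
  qed
  have "0 \<le> (\<Sum>d\<in>I. a d * (\<Sum>k\<in>{0..<int L}. z (k + d) * z k))"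
  proof -
    have "\<bar>z k\<bar> \<le> 1" for k
      using \<open>q > 0\<close> by (auto simp: z_def w_def c_def field_simps)
    moreover have "f (of_int d * (1 / real q)) = 0" if "\<bar>d\<bar> > int D" for d
    proof -
      have "\<bar>real_of_int d\<bar> > real D" using that by linarith
      then have "\<bar>of_int d * (1 / real q)\<bar> > real n + 1"
        using \<open>q > 0\<close> by (simp add: D_def field_simps abs_mult)
      then show ?thesis by (intro supp) (auto simp: Omega_def)
    qed
    ultimately show ?thesis
      using positive_definite_periodic_form[OF pd, where z = z and L = L and B = 1 and D = D and h = "1 / real q"]
        w_per by (simp add: I_def a_def z_def)
  qed
  also have "\<dots> = (\<Sum>d\<in>I. (if d = 0 then real n else 0) - real n * c * a d)"
  proof (rule sum.cong[OF refl])
    fix d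
    have "a d * (\<Sum>k\<in>{0..<int L}. w (k + d) * w k) = (if d = 0 then real n else 0)"
    proof (cases "d = 0")
      case True
      have "w k * w k = w k" for k by (simp add: w_def)
      then have "(\<Sum>k\<in>{0..<int L}. w k * w k) = real n"
        by (simp only: w_sum)
      with True f0 show ?thesis by (simp add: a_def)
    next
      case False
      then show ?thesis unfolding sum_distrib_left by (simp add: offdiag)
    qed
    then show "a d * (\<Sum>k\<in>{0..<int L}. z (k + d) * z k) = (if d = 0 then real n else 0) - real n * c * a d"
      unfolding corr right_diff_distrib by (simp only: mult.commute)
  qed
  also have "\<dots> = real n - real n * c * (\<Sum>d\<in>I. a d)"
    by (simp add: sum_subtractf sum_distrib_left I_def)
  finally have "real n * (c * (\<Sum>d\<in>I. a d)) \<le> real n * 1" by simp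
  then have "c * (\<Sum>d\<in>I. a d) \<le> 1"
    using \<open>n > 0\<close> by (simp only: mult_le_cancel_left_pos of_nat_0_less_iff)
  then show ?thesis
    using \<open>q > 0\<close> by (simp add: c_def a_def I_def D_def field_simps)
qed

section \<open>From grid sums to the integral\<close>

lemma integral_le_left_sum:
  fixes \<phi> :: "real \<Rightarrow> real"
  assumes "continuous_on {a..a + real m * h} \<phi>" "h \<ge> 0"
    and "\<And>k x. k < m \<Longrightarrow> a + real k * h \<le> x \<Longrightarrow> x \<le> a + real (Suc k) * h \<Longrightarrow> \<phi> x \<le> \<phi> (a + real k * h) + \<epsilon>"
  shows "integral {a..a + real m * h} \<phi> \<le> (\<Sum>k<m. \<phi> (a + real k * h)) * h + real m * h * \<epsilon>"
  using assms
proof (induction m)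
  case (Suc m)
  let ?b = "a + real m * h" and ?c = "a + real (Suc m) * h"
  have ab: "a \<le> ?b" and bc: "?b \<le> ?c" using \<open>h \<ge> 0\<close> by (auto simp: algebra_simps)
  have int: "\<phi> integrable_on {a..?c}"
    using Suc.prems(1) by (rule integrable_continuous_interval)
  have "integral {a..?c} \<phi> = integral {a..?b} \<phi> + integral {?b..?c} \<phi>"
    using Henstock_Kurzweil_Integration.integral_combine[OF ab bc int] by simp
  also have "integral {a..?b} \<phi> \<le> (\<Sum>k<m. \<phi> (a + real k * h)) * h + real m * h * \<epsilon>"
    using Suc.prems bc by (intro Suc.IH) (auto intro: continuous_on_subset)
  also have "integral {?b..?c} \<phi> \<le> integral {?b..?c} (\<lambda>x. \<phi> ?b + \<epsilon>)"
    using Suc.prems(3)[of m] ab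
    by (intro integral_le integrable_subinterval_real[OF int]) auto
  also have "\<dots> = h * (\<phi> ?b + \<epsilon>)"
    using bc by (simp add: algebra_simps)
  finally show ?case by (simp add: algebra_simps)
qed simp

lemma LINT_eq_integral_of_compact_support:
  fixes f :: "real \<Rightarrow> 'a::euclidean_space"
  assumes "continuous_on UNIV f" "\<And>x. x \<notin> {a..b} \<Longrightarrow> f x = 0"
  shows "(LINT x|lborel. f x) = integral {a..b} f"
proof -
  have "set_integrable lborel {a..b} f"
    using assms(1) by (intro borel_integrable_atLeastAtMost' continuous_on_subset[OF assms(1)]) auto
  then have "(LINT x:{a..b}|lborel. f x) = integral {a..b} f"
    by (rule set_borel_integral_eq_integral)
  moreover have "(\<lambda>x. indicat_real {a..b} x *\<^sub>R f x) = f"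
    using assms(2) by (auto simp: indicator_def)
  ultimately show ?thesis by (simp add: set_lebesgue_integral_def)
qed

lemma zero_outside_of_turan_class:
  assumes "f \<in> turan_class \<Omega>" "x \<notin> \<Omega>"
  shows "f x = 0"
  using assms closure_subset[of "support_on UNIV f"] by (auto simp: turan_class_def support_on_def)

lemma turan_class_integral_le:
  assumes f: "f \<in> turan_class (Omega (real n))" and "n > 0"
  shows "Re (LINT x|lborel. f x) \<le> 2"
proof -
  define R where "R = real (n + 1)"
  define \<phi> where "\<phi> = (\<lambda>x. Re (f x))"
  have cont: "continuous_on UNIV f" and pd: "positive_definite f" and f0: "f 0 = 1"
    using f by (auto simp: turan_class_def)
  have cont\<phi>: "continuous_on A \<phi>" for A
    unfolding \<phi>_def by (intro continuous_intros continuous_on_subset[OF cont]) auto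
  note supp = zero_outside_of_turan_class[OF f]
  have "(LINT x|lborel. f x) = integral {-R..R} f"
    using cont by (rule LINT_eq_integral_of_compact_support) (intro supp, auto simp: Omega_def R_def)
  also have "Re \<dots> = integral {-R..R} \<phi>"
    using integral_linear[OF integrable_continuous_interval[OF continuous_on_subset[OF cont]] bounded_linear_Re]
    by (simp add: \<phi>_def o_def)
  finally have Re_eq: "Re (LINT x|lborel. f x) = integral {-R..R} \<phi>" .
  have "integral {-R..R} \<phi> \<le> 2 + \<eta>" if "\<eta> > 0" for \<eta>
  proof -
    define \<epsilon> where "\<epsilon> = \<eta> / (2 * R)"
    have "R > 0" "\<epsilon> > 0" using that by (auto simp: R_def \<epsilon>_def)
    have "uniformly_continuous_on {-R..R} \<phi>"
      by (intro compact_uniformly_continuous cont\<phi> compact_Icc)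
    then obtain \<delta> where \<delta>: "\<delta> > 0"
      "\<And>x y. x \<in> {-R..R} \<Longrightarrow> y \<in> {-R..R} \<Longrightarrow> dist y x < \<delta> \<Longrightarrow> dist (\<phi> y) (\<phi> x) < \<epsilon>"
      using \<open>\<epsilon> > 0\<close> unfolding uniformly_continuous_on_def by metis
    obtain q where q: "q > 0" "1 / real q < \<delta>"
      using \<delta>(1) by (metis nat_approx_posE of_nat_Suc zero_less_Suc)
    define m where "m = 2 * (n + 1) * q"
    have mq: "real m * (1 / real q) = 2 * R" using q by (simp add: m_def R_def field_simps)
    have "integral {-R..-R + real m * (1 / real q)} \<phi>
      \<le> (\<Sum>k<m. \<phi> (-R + real k * (1 / real q))) * (1 / real q) + real m * (1 / real q) * \<epsilon>"
    proof (rule integral_le_left_sum[OF cont\<phi>])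
      fix k x
      assume k: "k < m" and x: "-R + real k * (1 / real q) \<le> x" "x \<le> -R + real (Suc k) * (1 / real q)"
      have "real (Suc k) * (1 / real q) \<le> real m * (1 / real q)"
        using k by (intro mult_right_mono) auto
      moreover have "0 \<le> real k * (1 / real q)" by simp
      moreover have "real (Suc k) * (1 / real q) = real k * (1 / real q) + 1 / real q"
        by (simp add: add_divide_distrib)
      moreover have "0 \<le> 1 / real q" by simp
      ultimately have "-R \<le> -R + real k * (1 / real q)" "-R + real k * (1 / real q) \<le> R"
        "-R \<le> x" "x \<le> R" "\<bar>x - (-R + real k * (1 / real q))\<bar> < \<delta>"
        using x q mq by linarith+
      then have "dist (\<phi> x) (\<phi> (-R + real k * (1 / real q))) < \<epsilon>"
        by (intro \<delta>(2)) (unfold dist_real_def atLeastAtMost_iff, blast+)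
      then show "\<phi> x \<le> \<phi> (-R + real k * (1 / real q)) + \<epsilon>"
        by (simp add: dist_real_def)
    qed simp
    moreover have "(\<Sum>k<m. \<phi> (-R + real k * (1 / real q))) \<le> 2 * real q"
    proof -
      define D where "D = int ((n + 1) * q)"
      \<comment> \<open>The left Riemann sum omits the right end point of the grid, where \<open>\<phi>\<close> vanishes.\<close>
      have "(\<Sum>k<m. \<phi> (-R + real k * (1 / real q))) = (\<Sum>d\<in>{-D..<D}. \<phi> (of_int d / q))"
      proof -
        have mD: "int m = 2 * D" by (simp add: m_def D_def)
        have RD: "R = of_int D / real q" using q by (simp add: R_def D_def field_simps)
        show ?thesis
          using mD by (intro sum.reindex_bij_witness[of _ "\<lambda>d. nat (d + D)" "\<lambda>k. int k - D"])
            (auto simp: RD diff_divide_distrib)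
      qed
      also have "\<dots> = (\<Sum>d\<in>{-D..D}. \<phi> (of_int d / q))"
      proof -
        have "of_int D / real q = real n + 1"
          using q by (simp add: D_def field_simps)
        then have "\<phi> (of_int D / q) = 0"
          using supp[of "real n + 1"] by (simp add: \<phi>_def Omega_def)
        moreover have "{-D..D} = insert D {-D..<D}" by (auto simp: D_def)
        ultimately show ?thesis by simp
      qed
      also have "\<dots> \<le> 2 * real q"
        unfolding \<phi>_def D_def using pd f0 supp \<open>n > 0\<close> q(1) by (rule positive_definite_grid_sum_le)
      finally show ?thesis .
    qed
    then have "(\<Sum>k<m. \<phi> (-R + real k * (1 / real q))) * (1 / real q) \<le> 2"
      using q by (simp add: field_simps)
    moreover have "-R + real m * (1 / real q) = R" "real m * (1 / real q) * \<epsilon> = \<eta>"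
      unfolding mq using \<open>R > 0\<close> by (simp_all add: \<epsilon>_def)
    ultimately show ?thesis by (metis add_right_mono order_trans)
  qed
  then show ?thesis
    unfolding Re_eq by (rule field_le_epsilon)
qed

section \<open>Near-extremal functions\<close>

definition tent :: "real \<Rightarrow> real \<Rightarrow> real" where
  "tent r x = max 0 (1 - \<bar>x\<bar> / r)"

lemma continuous_on_tent [continuous_intros]:
  "r > 0 \<Longrightarrow> continuous_on A g \<Longrightarrow> continuous_on A (\<lambda>x. tent r (g x))"
  unfolding tent_def by (intro continuous_intros) auto

lemma tent_eq_0: "r > 0 \<Longrightarrow> \<bar>x\<bar> \<ge> r \<Longrightarrow> tent r x = 0"
  by (auto simp: tent_def)

lemma has_bochner_integral_interval_overlap:
  assumes "r > 0"
  shows "has_bochner_integral lborel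
    (\<lambda>t. indicat_real {a..a + r} t * indicat_real {b..b + r} t) (r * tent r (a - b))"
proof -
  have "(\<lambda>t. indicat_real {a..a + r} t * indicat_real {b..b + r} t) = indicat_real {max a b..min a b + r}"
    by (auto simp: indicator_def fun_eq_iff)
  moreover have "measure lborel {max a b..min a b + r} = r * tent r (a - b)"
    using assms by (auto simp: tent_def field_simps max_def min_def)
  moreover have "has_bochner_integral lborel (indicat_real {max a b..min a b + r}) (measure lborel {max a b..min a b + r})"
    by (rule has_bochner_integral_real_indicator) (auto simp: emeasure_lborel_Icc_eq)
  ultimately show ?thesis by simp
qed

text \<open>
  When \<open>g (x - y)\<close> is an inner product of \<open>u x\<close> and \<open>u y\<close> in \<open>L\<^sup>2\<close>, the quadratic form
  of \<open>g\<close> is the squared norm of \<open>\<Sum>\<^sub>j z\<^sub>j u (x\<^sub>j)\<close>.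
\<close>
lemma positive_definite_of_gram:
  fixes u :: "real \<Rightarrow> 'a \<Rightarrow> real"
  assumes gram: "\<And>x y. has_bochner_integral M (\<lambda>t. u x t * u y t) (g (x - y))"
  shows "positive_definite (\<lambda>x. complex_of_real (g x))"
  unfolding positive_definite_def
proof (intro allI)
  fix m :: nat and x :: "nat \<Rightarrow> real" and z :: "nat \<Rightarrow> complex"
  define S where "S = (\<lambda>t. \<Sum>j=1..m. z j * of_real (u (x j) t))"
  have "has_bochner_integral M
      (\<lambda>t. \<Sum>j=1..m. \<Sum>k=1..m. z j * cnj (z k) * complex_of_real (u (x j) t * u (x k) t))
      (\<Sum>j=1..m. \<Sum>k=1..m. z j * cnj (z k) * complex_of_real (g (x j - x k)))"
    by (intro has_bochner_integral_sum has_bochner_integral_mult_right has_bochner_integral_of_real gram)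
  moreover have "(\<Sum>j=1..m. \<Sum>k=1..m. z j * cnj (z k) * complex_of_real (u (x j) t * u (x k) t))
      = complex_of_real ((cmod (S t))\<^sup>2)" for t
    unfolding complex_norm_square S_def by (simp add: sum_product mult_ac)
  ultimately have "(\<Sum>j=1..m. \<Sum>k=1..m. z j * cnj (z k) * complex_of_real (g (x j - x k)))
      = (LINT t|M. complex_of_real ((cmod (S t))\<^sup>2))"
    by (simp add: has_bochner_integral_integral_eq)
  also have "\<dots> = complex_of_real (LINT t|M. (cmod (S t))\<^sup>2)"
    by (rule integral_complex_of_real)
  also have "\<dots> \<in> \<real>\<^sub>\<ge>\<^sub>0" by simp
  finally show "(\<Sum>j=1..m. \<Sum>k=1..m. z j * cnj (z k) * complex_of_real (g (x j - x k))) \<in> \<real>\<^sub>\<ge>\<^sub>0" .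
qed

definition three_tents :: "real \<Rightarrow> real \<Rightarrow> real \<Rightarrow> real" where
  "three_tents l r x = tent r x + tent r (x - l) / 2 + tent r (x + l) / 2"

text \<open>
  With \<open>u x\<close> the sum of the indicators of \<open>[x, x + r]\<close> and \<open>[x + l, x + l + r]\<close>, the inner
  product of \<open>u x\<close> and \<open>u y\<close> has four overlaps: two give the tent at \<open>0\<close> and the others the
  tents at \<open>\<plusminus>l\<close>. This explains the weights \<open>1\<close>, \<open>1/2\<close>, \<open>1/2\<close>.
\<close>
lemma positive_definite_three_tents:
  assumes "r > 0"
  shows "positive_definite (\<lambda>x. complex_of_real (three_tents l r x))"
proof (rule positive_definite_of_gram)
  let ?I = "\<lambda>a. indicat_real {a..a + r}"
  let ?u = "\<lambda>x t. (?I x t + ?I (x + l) t) / sqrt (2 * r)"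
  fix x y :: real
  have "has_bochner_integral lborel
     (\<lambda>t. (?I x t * ?I y t + ?I x t * ?I (y + l) t + (?I (x + l) t * ?I y t + ?I (x + l) t * ?I (y + l) t)) / (2 * r))
     ((r * tent r (x - y) + r * tent r (x - (y + l)) + (r * tent r (x + l - y) + r * tent r (x + l - (y + l)))) / (2 * r))"
    using assms
    by (intro has_bochner_integral_divide has_bochner_integral_add has_bochner_integral_interval_overlap) auto
  also have "(\<lambda>t. (?I x t * ?I y t + ?I x t * ?I (y + l) t + (?I (x + l) t * ?I y t + ?I (x + l) t * ?I (y + l) t)) / (2 * r))
      = (\<lambda>t. ?u x t * ?u y t)"
    using assms by (simp add: algebra_simps add_divide_distrib)
  also have "(r * tent r (x - y) + r * tent r (x - (y + l)) + (r * tent r (x + l - y) + r * tent r (x + l - (y + l)))) / (2 * r)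
      = three_tents l r (x - y)"
    using assms by (simp add: three_tents_def field_simps)
  finally show "has_bochner_integral lborel (\<lambda>t. ?u x t * ?u y t) (three_tents l r (x - y))" .
qed

lemma has_bochner_integral_tent:
  assumes "r > 0"
  shows "has_bochner_integral lborel (tent r) r"
proof -
  have "(tent r has_integral (r / 2)) {-r..0}"
  proof -
    have "((\<lambda>x. 1 + x / r) has_integral (0 + 0\<^sup>2 / (2 * r)) - (- r + (- r)\<^sup>2 / (2 * r))) {-r..0}"
      using assms
      by (intro fundamental_theorem_of_calculus)
        (auto intro!: derivative_eq_intros simp: has_real_derivative_iff_has_vector_derivative[symmetric])
    then show ?thesis
      using assms by (subst has_integral_cong[where g = "\<lambda>x. 1 + x / r"])
        (auto simp: tent_def field_simps power2_eq_square)
  qed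
  moreover have "(tent r has_integral (r / 2)) {0..r}"
  proof -
    have "((\<lambda>x. 1 - x / r) has_integral (r - r\<^sup>2 / (2 * r)) - (0 - 0\<^sup>2 / (2 * r))) {0..r}"
      using assms
      by (intro fundamental_theorem_of_calculus)
        (auto intro!: derivative_eq_intros simp: has_real_derivative_iff_has_vector_derivative[symmetric])
    then show ?thesis
      using assms by (subst has_integral_cong[where g = "\<lambda>x. 1 - x / r"])
        (auto simp: tent_def field_simps power2_eq_square)
  qed
  ultimately have "(tent r has_integral (r / 2 + r / 2)) {-r..r}"
    using assms by (intro has_integral_combine[of "-r" 0 r]) auto
  then have "integral {-r..r} (tent r) = r" by (simp add: integral_unique)
  moreover have cont: "continuous_on UNIV (tent r)"
    using continuous_on_tent[OF assms continuous_on_id] by simp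
  ultimately have "(LINT x|lborel. tent r x) = r"
    using assms by (subst LINT_eq_integral_of_compact_support[of _ "-r" r]) (auto intro!: tent_eq_0)
  with assms show ?thesis
    by (metis has_bochner_integral_iff not_integrable_integral_eq less_irrefl)
qed

lemma integral_three_tents:
  assumes "r > 0"
  shows "(LINT x|lborel. three_tents l r x) = 2 * r"
proof -
  have shift: "has_bochner_integral lborel (\<lambda>x. tent r (x + c)) r" for c
    using lborel_has_bochner_integral_real_affine_iff[of 1 "tent r" r c] has_bochner_integral_tent[OF assms]
    by (simp add: add.commute)
  have "has_bochner_integral lborel (three_tents l r) (r + r / 2 + r / 2)"
    unfolding three_tents_def
    using shift[of 0] shift[of "-l"] shift[of l]
    by (intro has_bochner_integral_add has_bochner_integral_divide) auto
  then show ?thesis by (simp add: has_bochner_integral_integral_eq)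
qed

lemma three_tents_in_turan_class:
  assumes "0 < r" "r < 1" "l \<ge> 1"
  shows "(\<lambda>x. complex_of_real (three_tents l r x)) \<in> turan_class (Omega l)"
proof -
  have "support_on UNIV (\<lambda>x. complex_of_real (three_tents l r x))
      \<subseteq> {-r..r} \<union> {l - r..l + r} \<union> {- l - r..- l + r}" (is "?S \<subseteq> ?K")
  proof
    fix x assume "x \<in> ?S"
    then have "three_tents l r x \<noteq> 0" by (simp add: support_on_def)
    then have "\<bar>x\<bar> < r \<or> \<bar>x - l\<bar> < r \<or> \<bar>x + l\<bar> < r"
      using tent_eq_0[OF assms(1)] unfolding three_tents_def by (smt (verit) div_0)
    then show "x \<in> ?K" by auto
  qed
  then have "closure ?S \<subseteq> ?K" by (rule closure_minimal) auto
  also have "?K \<subseteq> Omega l" using assms by (auto simp: Omega_def)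
  finally have "closure ?S \<subseteq> Omega l" .
  moreover have "three_tents l r 0 = 1"
    using assms by (simp add: three_tents_def tent_def max_def field_simps)
  moreover have "continuous_on UNIV (\<lambda>x. complex_of_real (three_tents l r x))"
    unfolding three_tents_def using assms(1) by (intro continuous_intros) auto
  ultimately show ?thesis
    using positive_definite_three_tents[OF assms(1)] by (simp add: turan_class_def)
qed

theorem proposition4p1:
  fixes N :: int
  assumes "N \<ge> 3"
  shows "turan_constant (Omega (real_of_int N)) = 2"
proof (rule antisym)
  obtain n where N: "N = int n" "n > 0"
    using assms by (metis nonneg_int_cases of_nat_0_less_iff order_less_le_trans zero_less_numeral order_less_imp_le)
  show "turan_constant (Omega (real_of_int N)) \<le> 2"
    unfolding turan_constant_def using turan_class_integral_le[of _ n] N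
    by (intro SUP_least) auto
next
  show "2 \<le> turan_constant (Omega (real_of_int N))"
  proof (rule dense_le_bounded[of 0])
    fix w :: ereal assume "0 < w" "w < 2"
    then obtain v where v: "w = ereal v" "0 < v" "v < 2" by (cases w) auto
    let ?f = "\<lambda>x. complex_of_real (three_tents (real_of_int N) (v / 2) x)"
    have "?f \<in> turan_class (Omega (real_of_int N))"
      using v assms by (intro three_tents_in_turan_class) auto
    moreover have "Re (LINT x|lborel. ?f x) = v"
      using integral_three_tents[of "v / 2" "real_of_int N"] v by simp
    ultimately show "w \<le> turan_constant (Omega (real_of_int N))"
      unfolding turan_constant_def v(1) by (metis (no_types, lifting) SUP_upper)
  qed simp
qed

end
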